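(* Consider a three-qubit system with Hamiltonian $H=H_1\otimes\mathbf{I}\otimes\mathbf{I}+\mathbf{I}\otimes H_2\otimes\mathbf{I}+\mathbf{I}\otimes\mathbf{I}\otimes H_3$, where $H_i=\sum_{j=0}^1(E_i+j\alpha_i)|j\rangle\langle j|$ with $E_i\in\mathbb{R}$ and $\alpha_i>0$ for $i\in\{1,2,3\}$. Let $\rho$ be a three-qubit state that is separable across the $12$-vs-$3$ bipartition, and let $\Delta_{12|3}=W(\rho)-W_{[2]}(\rho_{12})-E(\rho_3)+E_g^{3}$. Then: (a) if $0<\alpha_1<\alpha_2=\alpha_3$, then $\Delta_{12|3}\le\dfrac{\alpha_1}{4}$; (b) if $\alpha_1=\alpha_2=\alpha>\alpha_3>0$ and $\alpha_3\ge\frac23\alpha$, then $\Delta_{12|3}\le\dfrac{\alpha-\alpha_3}{4}+\dfrac{\alpha}{4}$; (c) if $\alpha_1=\alpha_2=\alpha>\alpha_3>0$ and $\alpha_3\le\frac23\alpha$, then $\Delta_{12|3}\le\dfrac{\alpha-\alpha_3}{2}+\dfrac{\alpha}{6}$.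
   Context: A state is a positive semidefinite trace-one operator; $\rho_{12}$ and $\rho_3$ are the reduced states of $\rho$ on qubits 1,2 and on qubit 3. $\rho$ is separable across $12$-vs-$3$ if it is a convex combination of product states $\sigma_{12}\otimes\tau_3$. The energy of a state $\sigma$ of a (sub)system with Hamiltonian $K$ is $E(\sigma)=\mathrm{Tr}[\sigma K]$. The ergotropy of $\sigma$ with respect to $K$ is $\mathrm{Tr}[\sigma K]-\min_U\mathrm{Tr}[U\sigma U^\dagger K]$, the minimum being over all unitaries $U$ on the corresponding Hilbert space (here including all joint unitaries on qubits 1,2 in the case of $\rho_{12}$). $W(\rho)$ is the ergotropy of $\rho$ with respect to $H$, $W_{[2]}(\rho_{12})$ is the ergotropy of $\rho_{12}$ with respect to $H_1\otimes\mathbf{I}+\mathbf{I}\otimes H_2$, $E(\rho_3)=\mathrm{Tr}[\rho_3H_3]$, and $E_g^3=E_3$ is the ground-state energy of $H_3$. *)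

theory Defs
  imports "HOL-Analysis.Analysis"
begin

text \<open>
  Operators on a system whose computational basis is indexed by a finite type
  are square complex matrices over that type; a composite system is indexed by the
  product type.  A qubit has index type \<^typ>\<open>2\<close>, whose elements are \<open>0\<close> and \<open>1\<close>.
  The three-qubit space is bracketed as \<open>(2 \<times> 2) \<times> 2\<close>, so the bipartition 12-vs-3 is its
  outermost product.
\<close>

definition dagger :: "complex^'n^'m \<Rightarrow> complex^'m^'n" where
  "dagger A = map_matrix cnj (transpose A)"

definition unitary :: "complex^'n^'n \<Rightarrow> bool" where
  "unitary U \<longleftrightarrow> U ** dagger U = mat 1 \<and> dagger U ** U = mat 1"

definition psd :: "complex^'n^'n \<Rightarrow> bool" where
  "psd A \<longleftrightarrow> dagger A = A \<and>
     (\<forall>v. 0 \<le> Re (\<Sum>i\<in>UNIV. cnj (v $ i) * (A *v v) $ i))"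

definition state :: "complex^'n^'n \<Rightarrow> bool" where
  "state \<sigma> \<longleftrightarrow> psd \<sigma> \<and> trace \<sigma> = 1"

definition tensor :: "complex^'a^'a \<Rightarrow> complex^'b^'b \<Rightarrow> complex^('a::finite \<times> 'b::finite)^('a \<times> 'b)"
    (infixl "\<otimes>" 70) where
  "A \<otimes> B = (\<chi> i j. A $ fst i $ fst j * B $ snd i $ snd j)"

definition reduce_fst :: "complex^('a::finite \<times> 'b::finite)^('a \<times> 'b) \<Rightarrow> complex^'a^'a" where
  "reduce_fst \<rho> = (\<chi> i j. \<Sum>k\<in>UNIV. \<rho> $ (i, k) $ (j, k))"

definition reduce_snd :: "complex^('a::finite \<times> 'b::finite)^('a \<times> 'b) \<Rightarrow> complex^'b^'b" where
  "reduce_snd \<rho> = (\<chi> k l. \<Sum>i\<in>UNIV. \<rho> $ (i, k) $ (i, l))"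

definition separable :: "complex^('a::finite \<times> 'b::finite)^('a \<times> 'b) \<Rightarrow> bool" where
  "separable \<rho> \<longleftrightarrow> \<rho> \<in> convex hull {\<sigma> \<otimes> \<tau> | \<sigma> \<tau>. state \<sigma> \<and> state \<tau>}"

text \<open>The trace below is real whenever \<open>\<sigma>\<close> and \<open>K\<close> are self-adjoint.\<close>

definition energy :: "complex^'n^'n \<Rightarrow> complex^'n^'n \<Rightarrow> real" where
  "energy K \<sigma> = Re (trace (\<sigma> ** K))"

text \<open>The infimum is a minimum; see \<open>ergotropy_minimum\<close> below.\<close>

definition ergotropy :: "complex^'n^'n \<Rightarrow> complex^'n^'n \<Rightarrow> real" where
  "ergotropy K \<sigma> = energy K \<sigma> - (INF U\<in>{U. unitary U}. energy K (U ** \<sigma> ** dagger U))"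

definition ketbra :: "'n \<Rightarrow> 'n \<Rightarrow> complex^'n^'n" where
  "ketbra j k = (\<chi> r c. of_bool (r = j \<and> c = k))"

definition qubit_ham :: "real \<Rightarrow> real \<Rightarrow> complex^2^2" where
  "qubit_ham e a = (\<Sum>j = 0..1::nat. (e + real j * a) *\<^sub>R ketbra (of_nat j) (of_nat j))"

definition ham12 :: "(nat \<Rightarrow> real) \<Rightarrow> (nat \<Rightarrow> real) \<Rightarrow> complex^(2 \<times> 2)^(2 \<times> 2)" where
  "ham12 E \<alpha> = qubit_ham (E 1) (\<alpha> 1) \<otimes> mat 1 + mat 1 \<otimes> qubit_ham (E 2) (\<alpha> 2)"

definition ham123 :: "(nat \<Rightarrow> real) \<Rightarrow> (nat \<Rightarrow> real) \<Rightarrow> complex^((2 \<times> 2) \<times> 2)^((2 \<times> 2) \<times> 2)" where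
  "ham123 E \<alpha> =
     qubit_ham (E 1) (\<alpha> 1) \<otimes> mat 1 \<otimes> mat 1 +
     mat 1 \<otimes> qubit_ham (E 2) (\<alpha> 2) \<otimes> mat 1 +
     mat 1 \<otimes> mat 1 \<otimes> qubit_ham (E 3) (\<alpha> 3)"

text \<open>The final summand is the ground-state energy of qubit 3, which is \<open>E 3\<close> since \<open>\<alpha> 3 > 0\<close>.\<close>

definition gap_12_3 ::
    "(nat \<Rightarrow> real) \<Rightarrow> (nat \<Rightarrow> real) \<Rightarrow> complex^((2 \<times> 2) \<times> 2)^((2 \<times> 2) \<times> 2) \<Rightarrow> real" where
  "gap_12_3 E \<alpha> \<rho> =
     ergotropy (ham123 E \<alpha>) \<rho> - ergotropy (ham12 E \<alpha>) (reduce_fst \<rho>)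
       - energy (qubit_ham (E 3) (\<alpha> 3)) (reduce_snd \<rho>) + E 3"

lemma norm_unitary_entry:
  assumes "unitary U"
  shows "norm (U $ i $ j) \<le> 1"
proof -
  have "(U ** dagger U) $ i $ i = 1"
    using assms by (simp add: unitary_def mat_def)
  then have "(\<Sum>k\<in>UNIV. U $ i $ k * cnj (U $ i $ k)) = 1"
    by (simp add: matrix_matrix_mult_def dagger_def map_matrix_def transpose_def)
  then have "complex_of_real (\<Sum>k\<in>UNIV. (norm (U $ i $ k))\<^sup>2) = of_real 1"
    by (simp only: complex_norm_square of_real_sum of_real_1)
  then have "(\<Sum>k\<in>UNIV. (norm (U $ i $ k))\<^sup>2) = 1"
    by (simp only: of_real_eq_iff)
  moreover have "(norm (U $ i $ j))\<^sup>2 \<le> (\<Sum>k\<in>UNIV. (norm (U $ i $ k))\<^sup>2)"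
    by (rule member_le_sum) auto
  ultimately show ?thesis
    by (simp add: power2_le_iff_abs_le abs_square_le_1)
qed

lemma continuous_on_dagger [continuous_intros]:
  fixes f :: "'a::topological_space \<Rightarrow> complex^'n^'m"
  assumes "continuous_on S f"
  shows "continuous_on S (\<lambda>x. dagger (f x))"
  unfolding dagger_def map_matrix_def transpose_def
  by (intro continuous_intros assms | simp)+

lemma continuous_on_mmult:
  fixes f :: "'a::topological_space \<Rightarrow> complex^'n^'m" and g :: "'a \<Rightarrow> complex^'k^'n"
  assumes "continuous_on S f" "continuous_on S g"
  shows "continuous_on S (\<lambda>x. f x ** g x)"
  unfolding matrix_matrix_mult_def by (intro continuous_intros assms)

lemma compact_unitary: "compact {U :: complex^'n^'n. unitary U}"
proof -
  have "bounded {U :: complex^'n^'n. unitary U}"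
    unfolding bounded_iff
  proof (intro exI ballI)
    fix U :: "complex^'n^'n"
    assume U: "U \<in> {U. unitary U}"
    have "norm U \<le> (\<Sum>i\<in>UNIV. norm (U $ i))"
      unfolding norm_vec_def by (rule L2_set_le_sum) simp
    also have "\<dots> \<le> (\<Sum>i\<in>(UNIV::'n set). \<Sum>j\<in>(UNIV::'n set). norm (U $ i $ j))"
      by (rule sum_mono, subst norm_vec_def, rule L2_set_le_sum) simp
    also have "\<dots> \<le> (\<Sum>i\<in>(UNIV::'n set). \<Sum>j\<in>(UNIV::'n set). 1)"
      using U norm_unitary_entry by (intro sum_mono) auto
    finally show "norm U \<le> (\<Sum>i\<in>(UNIV::'n set). \<Sum>j\<in>(UNIV::'n set). 1)" .
  qed
  moreover have "closed {U :: complex^'n^'n. unitary U}"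
    unfolding unitary_def
    by (intro closed_Collect_conj closed_Collect_eq continuous_on_mmult continuous_intros)
  ultimately show ?thesis by (simp add: compact_eq_bounded_closed)
qed

lemma ergotropy_minimum:
  fixes K \<sigma> :: "complex^'n^'n"
  obtains U where "unitary U"
    and "\<And>V. unitary V \<Longrightarrow> energy K (U ** \<sigma> ** dagger U) \<le> energy K (V ** \<sigma> ** dagger V)"
    and "ergotropy K \<sigma> = energy K \<sigma> - energy K (U ** \<sigma> ** dagger U)"
proof -
  let ?f = "\<lambda>U. energy K (U ** \<sigma> ** dagger U)"
  have one: "unitary (mat 1 :: complex^'n^'n)"
  proof -
    have "dagger (mat 1 :: complex^'n^'n) = mat 1"
      by (simp add: dagger_def map_matrix_def transpose_def mat_def vec_eq_iff)
    then show ?thesis by (simp add: unitary_def)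
  qed
  have "continuous_on {U. unitary U} ?f"
    unfolding energy_def trace_def
    by (intro continuous_intros continuous_on_mmult)
  then obtain U where U: "unitary U" "\<And>V. unitary V \<Longrightarrow> ?f U \<le> ?f V"
    using continuous_attains_inf[OF compact_unitary, of ?f] one by blast
  have "(INF V\<in>{V. unitary V}. ?f V) = ?f U"
    using U by (intro cInf_eq_minimum) auto
  with U that show ?thesis by (simp add: ergotropy_def)
qed

end

theory Submission
  imports Defs
begin

text \<open>
  The mean energies cancel in \<open>\<Delta>\<close>, leaving \<open>E_3\<close> plus the passive energy of \<open>\<rho>\<^sub>1\<^sub>2\<close> minus that
  of \<open>\<rho>\<close>.  A separable \<open>\<rho>\<close> satisfies \<open>\<rho> \<le> \<rho>\<^sub>1\<^sub>2 \<otimes> I\<close>, which makes the spectrum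
  \<open>x_1 \<ge> x_2 \<ge> x_3 \<ge> x_4\<close> of \<open>\<rho>\<^sub>1\<^sub>2\<close> majorize that of \<open>\<rho>\<close>: if \<open>\<rho> e_l = p_l e_l\<close> and
  \<open>\<rho>\<^sub>1\<^sub>2 v_i = x_i v_i\<close>, then \<open>D_l_i = (p_l / x_i) \<langle>e_l, (|v_i\<rangle>\<langle>v_i| \<otimes> I) e_l\<rangle>\<close> is doubly
  substochastic and \<open>p = D x\<close>.  Hence the passive energy of \<open>\<rho>\<close> is at least the one with populations
  \<open>x_i\<close> in the four lowest levels of \<open>H\<close>.  Comparing these with the levels of \<open>H_1 + H_2\<close> gives
  \<open>\<Delta> \<le> \<alpha>_1 x_4\<close> in case (a) and \<open>\<Delta> \<le> (\<alpha> - \<alpha>_3) x_2 + \<alpha> x_4\<close> in cases (b) and (c).  Since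
  \<open>x_4 \<le> 1/4\<close> and \<open>x_2 + x_4 \<le> 1/2\<close>, the latter is at most \<open>(\<alpha> - \<alpha>_3)/4 + \<alpha>/4\<close>, which does not
  exceed the bound of (c) when \<open>\<alpha>_3 \<le> 2\<alpha>/3\<close>.
\<close>

section \<open>Complex inner products and quadratic forms\<close>

definition cip :: "complex^'n \<Rightarrow> complex^'n \<Rightarrow> complex" where
  "cip v w = (\<Sum>i\<in>UNIV. cnj (v $ i) * w $ i)"

lemma cip_add_right: "cip u (v + w) = cip u v + cip u w"
  by (simp add: cip_def algebra_simps sum.distrib)

lemma cip_add_left: "cip (u + v) w = cip u w + cip v w"
  by (simp add: cip_def algebra_simps sum.distrib)

lemma cip_scale_right: "cip u (c *s v) = c * cip u v"
  by (simp add: cip_def algebra_simps sum_distrib_left)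

lemma cip_scale_left: "cip (c *s u) v = cnj c * cip u v"
  by (simp add: cip_def algebra_simps sum_distrib_left)

lemma cip_diff_right: "cip u (v - w) = cip u v - cip u w"
  by (simp add: cip_def algebra_simps sum_subtractf)

lemma cip_zero_right [simp]: "cip u 0 = 0"
  by (simp add: cip_def)

lemma cip_sum_right: "cip u (\<Sum>i\<in>S. f i) = (\<Sum>i\<in>S. cip u (f i))"
  by (induction S rule: infinite_finite_induct) (simp_all add: cip_add_right)

lemma cnj_cip: "cnj (cip v w) = cip w v"
  by (simp add: cip_def mult.commute)

lemma cip_self: "cip v v = complex_of_real ((norm v)\<^sup>2)"
proof -
  have "(norm v)\<^sup>2 = (\<Sum>i\<in>UNIV. (norm (v $ i))\<^sup>2)"
    by (simp add: norm_vec_def L2_set_def sum_nonneg)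
  then show ?thesis
    by (simp add: cip_def complex_norm_square mult.commute del: of_real_power)
qed

lemma cip_mult_right: "cip v (A *v w) = cip (dagger A *v v) w"
proof -
  have "cip v (A *v w) = (\<Sum>i\<in>UNIV. \<Sum>j\<in>UNIV. cnj (v $ i) * A $ i $ j * w $ j)"
    by (simp add: cip_def matrix_vector_mult_def sum_distrib_left mult.assoc)
  also have "\<dots> = (\<Sum>j\<in>UNIV. \<Sum>i\<in>UNIV. cnj (v $ i) * A $ i $ j * w $ j)"
    by (rule sum.swap)
  also have "\<dots> = cip (dagger A *v v) w"
    by (simp add: cip_def matrix_vector_mult_def dagger_def map_matrix_def transpose_def
        sum_distrib_right sum_distrib_left mult_ac)
  finally show ?thesis .
qed

text \<open>A real-valued form is what order and extremum arguments need; for self-adjoint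
  \<open>A\<close> the real part loses nothing, by \<open>hermitian_cip_self\<close>.\<close>

definition qf :: "complex^'n^'n \<Rightarrow> complex^'n \<Rightarrow> real" where
  "qf A v = Re (cip v (A *v v))"

lemma psd_iff: "psd A \<longleftrightarrow> dagger A = A \<and> (\<forall>v. 0 \<le> qf A v)"
  by (simp add: psd_def qf_def cip_def)

lemma hermitian_cip: "dagger A = A \<Longrightarrow> cip (A *v v) w = cip v (A *v w)"
  by (simp add: cip_mult_right)

lemma hermitian_cip_self:
  assumes "dagger A = A"
  shows "cip v (A *v v) = complex_of_real (qf A v)"
proof -
  have "cnj (cip v (A *v v)) = cip v (A *v v)"
    by (simp add: cnj_cip hermitian_cip[OF assms])
  then show ?thesis
    by (simp add: qf_def complex_eq_iff)
qed

lemma continuous_on_cip [continuous_intros]: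
  assumes "continuous_on S f" "continuous_on S g"
  shows "continuous_on S (\<lambda>x. cip (f x) (g x))"
  unfolding cip_def by (intro continuous_intros assms)

lemma matrix_vector_mult_scale: "A *v (c *s v) = c *s (A *v (v :: complex^'n))"
  by (simp add: vec_eq_iff matrix_vector_mult_def sum_distrib_left mult_ac)

text \<open>The two cross terms are complex conjugates. The linear term in \<open>t\<close> drives
  the variational argument in \<open>exists_next_eigenvector\<close>.\<close>

lemma qf_add_scaled:
  assumes "dagger A = A"
  shows "qf A (v + complex_of_real t *s w) =
    qf A v + 2 * t * Re (cip w (A *v v)) + t\<^sup>2 * qf A w"
proof -
  have "cip v (A *v w) = cnj (cip w (A *v v))"
    by (simp add: cnj_cip hermitian_cip[OF assms])
  then show ?thesis
    by (simp add: qf_def matrix_vector_right_distrib cip_add_left cip_add_right cip_scale_left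
        cip_scale_right matrix_vector_mult_scale algebra_simps power2_eq_square)
qed

section \<open>Spectral theorem for self-adjoint matrices\<close>

text \<open>The conditions form a square system whose row \<open>a\<close> is zero, so its matrix is
  singular and has a nontrivial kernel.\<close>

lemma exists_orthogonal_vector:
  fixes v :: "'n \<Rightarrow> complex^'n"
  assumes "a \<notin> S"
  obtains w where "w \<noteq> 0" "\<And>j. j \<in> S \<Longrightarrow> cip (v j) w = 0"
proof -
  define B :: "complex^'n^'n" where
    "B = (\<chi> i. if i \<in> S then (\<chi> j. cnj (v i $ j)) else 0)"
  have "row a B = 0"
    using assms by (simp add: row_def B_def vec_eq_iff)
  then have "det B = 0"
    by (simp add: det_zero_row)
  then have "\<not> invertible B"
    by (simp add: invertible_det_nz)
  then obtain w where w: "B *v w = 0" "w \<noteq> 0"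
    using matrix_left_invertible_ker[of B] invertible_left_inverse[of B] by blast
  have "cip (v j) w = (B *v w) $ j" if "j \<in> S" for j
    using that by (simp add: cip_def B_def matrix_vector_mult_def)
  with w show ?thesis
    by (intro that[of w]) simp_all
qed

lemma norm_scale_complex: "norm (c *s (v :: complex^'n)) = cmod c * norm v"
  by (simp add: norm_vec_def L2_set_def norm_mult power_mult_distrib
      flip: sum_distrib_left) (simp add: real_sqrt_mult)

text \<open>A maximizer of the Rayleigh quotient on the complement of known eigenvectors is again an
  eigenvector: otherwise moving it towards its residual would increase the quotient.\<close>

lemma exists_next_eigenvector:
  fixes A :: "complex^'n^'n" and v :: "'n \<Rightarrow> complex^'n"
  assumes herm: "dagger A = A" and a: "a \<notin> S"
    and eig: "\<And>j. j \<in> S \<Longrightarrow> A *v v j = complex_of_real (x j) *s v j"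
  obtains u l where "cip u u = 1" "A *v u = complex_of_real l *s u"
    "\<And>j. j \<in> S \<Longrightarrow> cip (v j) u = 0"
proof -
  define C where "C = {u. norm u = 1 \<and> (\<forall>j\<in>S. cip (v j) u = 0)}"
  have "bounded C"
    by (rule boundedI[where B=1]) (simp add: C_def)
  moreover have "closed C"
    unfolding C_def Ball_def
    by (intro closed_Collect_conj closed_Collect_all closed_Collect_imp closed_Collect_eq
        continuous_intros open_Collect_const)
  ultimately have "compact C"
    by (simp add: compact_eq_bounded_closed)
  obtain w where w: "w \<noteq> 0" "\<And>j. j \<in> S \<Longrightarrow> cip (v j) w = 0"
    using exists_orthogonal_vector[OF a, of v] by blast
  have "complex_of_real (1 / norm w) *s w \<in> C"
    using w by (simp add: C_def cip_scale_right norm_scale_complex norm_divide)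
  then have "C \<noteq> {}" by blast
  have "continuous_on C (qf A)"
    unfolding qf_def matrix_vector_mult_def by (intro continuous_intros)
  then obtain u where u: "u \<in> C" "\<And>y. y \<in> C \<Longrightarrow> qf A y \<le> qf A u"
    using continuous_attains_sup[OF \<open>compact C\<close> \<open>C \<noteq> {}\<close>] by blast
  define l where "l = qf A u"
  define r where "r = A *v u - complex_of_real l *s u"
  have u1: "norm u = 1" and u_orth: "\<And>j. j \<in> S \<Longrightarrow> cip (v j) u = 0"
    using u(1) by (auto simp: C_def)
  have cuu: "cip u u = 1"
    by (simp add: cip_self u1)
  have cAu: "cip u (A *v u) = complex_of_real l"
    by (simp add: l_def hermitian_cip_self[OF herm])
  \<comment> \<open>Orthogonality to \<open>u\<close> keeps the squared norm of
    \<open>u + t r\<close> free of a linear term in \<open>t\<close>; orthogonality to the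
    \<open>v j\<close> keeps that vector, once normalized, in \<open>C\<close>.\<close>
  have r_orth_u: "cip u r = 0"
    by (simp add: r_def cip_diff_right cip_scale_right cuu cAu)
  have r_orth: "cip (v j) r = 0" if "j \<in> S" for j
  proof -
    have "cip (v j) (A *v u) = 0"
      using that by (simp add: hermitian_cip[OF herm, symmetric] eig cip_scale_left u_orth)
    then show ?thesis
      using that by (simp add: r_def cip_diff_right cip_scale_right u_orth)
  qed
  have ru: "cip r u = 0"
    using r_orth_u cnj_cip[of u r] by simp
  have rAu: "cip r (A *v u) = complex_of_real ((norm r)\<^sup>2)"
  proof -
    have "cip r r = cip r (A *v u)"
      by (subst (2) r_def) (simp add: cip_diff_right cip_scale_right ru)
    then show ?thesis by (simp add: cip_self)
  qed
  \<comment> \<open>Maximality of \<open>l\<close> is tested at \<open>u + t r\<close>: the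
    first-order gain must be absorbed by second-order terms. Division by \<open>t\<close> and
    \<open>t\<close> tending to 0 then force \<open>r = 0\<close>.\<close>
  have bound: "2 * (norm r)\<^sup>2 \<le> t * (l * (norm r)\<^sup>2 - qf A r)" if "t > 0" for t
  proof -
    define y where "y = u + complex_of_real t *s r"
    have "cip y y = complex_of_real (1 + t\<^sup>2 * (norm r)\<^sup>2)"
      by (simp add: y_def cip_add_left cip_add_right cip_scale_left cip_scale_right cuu ru r_orth_u
          cip_self[of r] power2_eq_square)
    then have ny: "(norm y)\<^sup>2 = 1 + t\<^sup>2 * (norm r)\<^sup>2"
      using cip_self[of y] of_real_eq_iff by metis
    then have y0: "(norm y)\<^sup>2 > 0"
      by (simp add: add_pos_nonneg)
    then have "norm y > 0" by simp
    have y_orth: "cip (v j) y = 0" if "j \<in> S" for j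
      using that by (simp add: y_def cip_add_right cip_scale_right u_orth r_orth)
    have "complex_of_real (1 / norm y) *s y \<in> C"
      using \<open>norm y > 0\<close> y_orth
      by (simp add: C_def norm_scale_complex norm_divide cip_scale_right)
    then have "qf A (complex_of_real (1 / norm y) *s y) \<le> l"
      using u(2) by (simp add: l_def)
    moreover have "qf A (complex_of_real c *s y) = c\<^sup>2 * qf A y" for c
      by (simp add: qf_def matrix_vector_mult_scale cip_scale_left cip_scale_right power2_eq_square)
    ultimately have "qf A y / (norm y)\<^sup>2 \<le> l"
      by (simp add: power_divide del: of_real_divide)
    then have "qf A y \<le> l * (1 + t\<^sup>2 * (norm r)\<^sup>2)"
      using y0 by (simp add: divide_le_eq ny)
    moreover have "qf A y = l + 2 * t * (norm r)\<^sup>2 + t\<^sup>2 * qf A r"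
      by (simp add: y_def qf_add_scaled[OF herm] rAu l_def)
    ultimately have "t * (2 * (norm r)\<^sup>2) \<le> t * (t * (l * (norm r)\<^sup>2 - qf A r))"
      by (simp add: algebra_simps power2_eq_square)
    with that show ?thesis
      by (simp only: mult_le_cancel_left_pos)
  qed
  have "((\<lambda>t. t * (l * (norm r)\<^sup>2 - qf A r)) \<longlongrightarrow> 0 * (l * (norm r)\<^sup>2 - qf A r)) (at_right 0)"
    by (intro tendsto_intros)
  then have "2 * (norm r)\<^sup>2 \<le> 0 * (l * (norm r)\<^sup>2 - qf A r)"
    by (rule tendsto_lowerbound) (auto simp: eventually_at_right_less bound intro!: eventually_at_rightI[of 0 1])
  then have "r = 0" by simp
  then show ?thesis
    using that[of u l] cuu u_orth by (simp add: r_def)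
qed

text \<open>The family is indexed by the coordinate type itself, so orthonormality already makes it
  a basis.\<close>

definition onb :: "('n \<Rightarrow> complex^'n) \<Rightarrow> bool" where
  "onb v \<longleftrightarrow> (\<forall>i j. cip (v i) (v j) = of_bool (i = j))"

text \<open>Eigenvectors are adjoined one index at a time; the induction constrains \<open>v\<close>
  and \<open>x\<close> only on the finite set \<open>S\<close> reached so far.\<close>

lemma hermitian_eigenbasis:
  fixes A :: "complex^'n^'n"
  assumes "dagger A = A"
  obtains v x where "onb v" "\<And>i. A *v v i = complex_of_real (x i) *s v i"
proof -
  have "\<exists>v x. (\<forall>i\<in>S. \<forall>j\<in>S. cip (v i) (v j) = of_bool (i = j)) \<and>
      (\<forall>i\<in>S. A *v v i = complex_of_real (x i) *s v i)" if "finite S" for S :: "'n set"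
    using that
  proof (induction S)
    case empty
    then show ?case by simp
  next
    case (insert a S)
    then obtain v x where vx: "\<And>i j. i \<in> S \<Longrightarrow> j \<in> S \<Longrightarrow> cip (v i) (v j) = of_bool (i = j)"
      "\<And>i. i \<in> S \<Longrightarrow> A *v v i = complex_of_real (x i) *s v i"
      by blast
    obtain u l where ul: "cip u u = 1" "A *v u = complex_of_real l *s u"
      "\<And>j. j \<in> S \<Longrightarrow> cip (v j) u = 0"
      using exists_next_eigenvector[OF assms insert(2), of v x] vx(2) by blast
    have "cip u (v j) = 0" if "j \<in> S" for j
      using ul(3)[OF that] cnj_cip[of "v j" u] by simp
    with ul vx insert(2) show ?case
      by (intro exI[of _ "v(a := u)"] exI[of _ "x(a := l)"]) auto
  qed
  from this[of UNIV] show ?thesis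
    using that by (auto simp: onb_def)
qed

section \<open>Expansions in orthonormal bases\<close>

text \<open>A one-sided inverse of a square matrix is two-sided, so orthonormal rows give
  orthonormal columns.\<close>

lemma onb_complete:
  fixes v :: "'n \<Rightarrow> complex^'n"
  assumes "onb v"
  shows "(\<Sum>i\<in>UNIV. v i $ a * cnj (v i $ b)) = of_bool (a = b)"
proof -
  define V :: "complex^'n^'n" where "V = (\<chi> i j. cnj (v i $ j))"
  have "V ** dagger V = mat 1"
    using assms by (simp add: onb_def cip_def V_def dagger_def map_matrix_def transpose_def
        matrix_matrix_mult_def mat_def vec_eq_iff of_bool_def)
  then have "dagger V ** V = mat 1"
    by (simp add: matrix_left_right_inverse)
  then have "(dagger V ** V) $ a $ b = of_bool (a = b)"
    by (simp add: mat_def)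
  then show ?thesis
    by (simp add: V_def dagger_def map_matrix_def transpose_def matrix_matrix_mult_def)
qed

lemma onb_unitary:
  fixes v :: "'n \<Rightarrow> complex^'n"
  assumes "onb v"
  shows "unitary (\<chi> i j. cnj (v i $ j))"
proof -
  let ?V = "\<chi> i j. cnj (v i $ j)"
  have "?V ** dagger ?V = mat 1"
    using assms by (simp add: onb_def cip_def dagger_def map_matrix_def transpose_def
        matrix_matrix_mult_def mat_def vec_eq_iff of_bool_def)
  then show ?thesis
    by (simp add: unitary_def matrix_left_right_inverse)
qed

lemma unitary_onb:
  assumes "unitary U"
  shows "onb (\<lambda>i. \<chi> j. cnj (U $ i $ j))"
proof -
  have "(U ** dagger U) $ i $ j = of_bool (i = j)" for i j
    using assms by (simp add: unitary_def mat_def)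
  then show ?thesis
    by (simp add: onb_def cip_def dagger_def map_matrix_def transpose_def matrix_matrix_mult_def)
qed

text \<open>The conjugated rows of a unitary form an orthonormal basis, so level populations after a
  rotation are expectation values in such a basis.\<close>

lemma conj_unitary_diag:
  "(U ** A ** dagger U) $ i $ i = cip (\<chi> j. cnj (U $ i $ j)) (A *v (\<chi> j. cnj (U $ i $ j)))"
  unfolding matrix_mul_assoc[symmetric]
  by (simp add: cip_def dagger_def map_matrix_def transpose_def matrix_matrix_mult_def
      matrix_vector_mult_def)

lemma onb_parseval:
  assumes "onb v"
  shows "(\<Sum>i\<in>UNIV. (cmod (cip (v i) w))\<^sup>2) = (norm w)\<^sup>2"
proof -
  have "complex_of_real (\<Sum>i\<in>UNIV. (cmod (cip (v i) w))\<^sup>2) =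
      (\<Sum>i\<in>UNIV. cip (v i) w * cip w (v i))"
    by (simp add: complex_norm_square cnj_cip del: of_real_power)
  also have "\<dots> = (\<Sum>i\<in>UNIV. \<Sum>a\<in>UNIV. \<Sum>b\<in>UNIV. (v i $ b * cnj (v i $ a)) * (w $ a * cnj (w $ b)))"
    by (simp add: cip_def sum_product mult_ac)
  also have "\<dots> = (\<Sum>a\<in>UNIV. \<Sum>b\<in>UNIV. \<Sum>i\<in>UNIV. (v i $ b * cnj (v i $ a)) * (w $ a * cnj (w $ b)))"
    by (subst sum.swap, rule sum.cong[OF refl], rule sum.swap)
  also have "\<dots> = (\<Sum>a\<in>UNIV. \<Sum>b\<in>UNIV. of_bool (b = a) * (w $ a * cnj (w $ b)))"
    by (simp add: onb_complete[OF assms] flip: sum_distrib_right)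
  also have "\<dots> = complex_of_real ((norm w)\<^sup>2)"
    unfolding cip_self[symmetric]
    by (simp add: of_bool_def if_distrib[of "\<lambda>x. x * _"] cip_def mult.commute cong: if_cong)
  finally show ?thesis
    using of_real_eq_iff by blast
qed

text \<open>Spectral decomposition: \<open>A\<close> applied to the completeness relation of
  \<open>v\<close>.\<close>

lemma eigen_entries:
  assumes "onb v" "\<And>i. A *v v i = complex_of_real (x i) *s v i"
  shows "A $ a $ b = (\<Sum>i\<in>UNIV. complex_of_real (x i) * v i $ a * cnj (v i $ b))"
proof -
  have "(\<Sum>i\<in>UNIV. complex_of_real (x i) * v i $ a * cnj (v i $ b)) =
      (\<Sum>i\<in>UNIV. (A *v v i) $ a * cnj (v i $ b))"
    by (simp add: assms)
  also have "\<dots> = (\<Sum>i\<in>UNIV. \<Sum>c\<in>UNIV. A $ a $ c * (v i $ c * cnj (v i $ b)))"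
    by (simp add: matrix_vector_mult_def sum_distrib_right sum_distrib_left mult_ac)
  also have "\<dots> = (\<Sum>c\<in>UNIV. A $ a $ c * (\<Sum>i\<in>UNIV. v i $ c * cnj (v i $ b)))"
    by (subst sum.swap) (simp add: sum_distrib_left)
  also have "\<dots> = A $ a $ b"
    by (simp add: onb_complete[OF assms(1)] of_bool_def if_distrib cong: if_cong)
  finally show ?thesis by simp
qed

lemma qf_eigen:
  assumes "onb v" "\<And>i. A *v v i = complex_of_real (x i) *s v i"
  shows "qf A w = (\<Sum>i\<in>UNIV. x i * (cmod (cip (v i) w))\<^sup>2)"
proof -
  have "cip w (A *v w) = (\<Sum>a\<in>UNIV. \<Sum>b\<in>UNIV. \<Sum>i\<in>UNIV.
      complex_of_real (x i) * (v i $ a * cnj (w $ a)) * (cnj (v i $ b) * w $ b))"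
    by (simp add: cip_def matrix_vector_mult_def eigen_entries[OF assms] sum_distrib_left
        sum_distrib_right mult_ac)
  also have "\<dots> = (\<Sum>a\<in>UNIV. \<Sum>i\<in>UNIV. \<Sum>b\<in>UNIV.
      complex_of_real (x i) * (v i $ a * cnj (w $ a)) * (cnj (v i $ b) * w $ b))"
    by (rule sum.cong[OF refl], rule sum.swap)
  also have "\<dots> = (\<Sum>i\<in>UNIV. \<Sum>a\<in>UNIV. \<Sum>b\<in>UNIV.
      complex_of_real (x i) * (v i $ a * cnj (w $ a)) * (cnj (v i $ b) * w $ b))"
    by (rule sum.swap)
  also have "\<dots> = (\<Sum>i\<in>UNIV. complex_of_real (x i) * (cip w (v i) * cip (v i) w))"
    by (simp add: cip_def sum_product sum_distrib_left sum_distrib_right mult_ac)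
  also have "\<dots> = complex_of_real (\<Sum>i\<in>UNIV. x i * (cmod (cip (v i) w))\<^sup>2)"
    by (simp add: complex_norm_square cnj_cip mult_ac del: of_real_power)
  finally show ?thesis
    by (simp add: qf_def)
qed

lemma onb_norm: "onb v \<Longrightarrow> norm (v i) = 1"
  using cip_self[of "v i"] of_real_eq_iff[of "(norm (v i))\<^sup>2" 1, where 'a=complex]
  by (simp add: onb_def power2_eq_1_iff) (metis norm_ge_zero not_one_le_zero neg_0_le_iff_le)

lemma eigenvalue_eq_qf:
  assumes "onb v" "\<And>i. A *v v i = complex_of_real (x i) *s v i"
  shows "x i = qf A (v i)"
  using assms by (simp add: qf_def cip_scale_right onb_def)

lemma trace_eigen:
  assumes "onb v" "\<And>i. A *v v i = complex_of_real (x i) *s v i"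
  shows "trace A = complex_of_real (\<Sum>i\<in>UNIV. x i)"
proof -
  have "trace A = (\<Sum>i\<in>UNIV. \<Sum>a\<in>UNIV. complex_of_real (x i) * v i $ a * cnj (v i $ a))"
    unfolding trace_def eigen_entries[OF assms] by (rule sum.swap)
  also have "\<dots> = (\<Sum>i\<in>UNIV. complex_of_real (x i) * cip (v i) (v i))"
    by (simp add: cip_def sum_distrib_left mult_ac)
  finally show ?thesis
    using assms(1) by (simp add: onb_def)
qed

lemma psd_eigenvalue_nonneg:
  assumes "psd A" "onb v" "\<And>i. A *v v i = complex_of_real (x i) *s v i"
  shows "x i \<ge> 0"
  using assms(1) eigenvalue_eq_qf[OF assms(2,3)] by (simp add: psd_iff)

text \<open>Each eigenvalue is at most the sum of all of them. For a state this says that it is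
  dominated by the identity.\<close>

lemma psd_qf_le_trace:
  assumes "psd A"
  shows "qf A w \<le> Re (trace A) * (norm w)\<^sup>2"
proof -
  obtain v x where vx: "onb v" "\<And>i. A *v v i = complex_of_real (x i) *s v i"
    using hermitian_eigenbasis assms by (metis psd_def)
  note x0 = psd_eigenvalue_nonneg[OF assms vx]
  have "x i \<le> (\<Sum>i\<in>UNIV. x i)" for i
    by (rule member_le_sum) (auto simp: x0)
  then have "qf A w \<le> (\<Sum>i\<in>UNIV. (\<Sum>i\<in>UNIV. x i) * (cmod (cip (v i) w))\<^sup>2)"
    unfolding qf_eigen[OF vx] by (intro sum_mono mult_right_mono) auto
  then show ?thesis
    by (simp add: trace_eigen[OF vx] onb_parseval[OF vx(1)] flip: sum_distrib_left)
qed

section \<open>Tensor products and partial contractions\<close>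

definition vtensor :: "complex^'a \<Rightarrow> complex^'b \<Rightarrow> complex^('a \<times> 'b)" where
  "vtensor u z = (\<chi> p. u $ fst p * z $ snd p)"

text \<open>The contraction \<open>(\<langle>u| \<otimes> I) w\<close>.\<close>

definition slice :: "complex^'a \<Rightarrow> complex^('a \<times> 'b) \<Rightarrow> complex^'b" where
  "slice u w = (\<chi> m. \<Sum>a\<in>UNIV. cnj (u $ a) * w $ (a, m))"

lemma sum_UNIV_prod:
  "(\<Sum>p\<in>(UNIV :: ('a::finite \<times> 'b::finite) set). f p) = (\<Sum>a\<in>UNIV. \<Sum>b\<in>UNIV. f (a, b))"
  by (simp add: sum.cartesian_product flip: UNIV_Times_UNIV)

lemma cip_vtensor_left: "cip (vtensor u z) w = cip z (slice u w)"
  unfolding cip_def sum_UNIV_prod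
  by (subst sum.swap) (simp add: vtensor_def slice_def sum_distrib_left mult_ac)

lemma cip_vtensor_right: "cip w (vtensor u z) = cip (slice u w) z"
  by (metis cip_vtensor_left cnj_cip)

lemma tensor_mult_vtensor: "(A \<otimes> B) *v vtensor u z = vtensor (A *v u) (B *v z)"
  by (simp add: vec_eq_iff vtensor_def tensor_def matrix_vector_mult_def sum_UNIV_prod sum_product
      mult_ac)

lemma vtensor_scale_left: "vtensor (c *s u) z = c *s vtensor u z"
  by (simp add: vec_eq_iff vtensor_def mult_ac)

text \<open>The completeness relation of \<open>v\<close>, tensored with the identity.\<close>

lemma vtensor_slice_decomp:
  assumes "onb v"
  shows "(\<Sum>i\<in>UNIV. vtensor (v i) (slice (v i) w)) = w"
proof -
  have "(\<Sum>i\<in>UNIV. v i $ a * (\<Sum>b\<in>UNIV. cnj (v i $ b) * w $ (b, m))) = w $ (a, m)" for a m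
  proof -
    have "(\<Sum>i\<in>UNIV. v i $ a * (\<Sum>b\<in>UNIV. cnj (v i $ b) * w $ (b, m))) =
        (\<Sum>b\<in>UNIV. (\<Sum>i\<in>UNIV. v i $ a * cnj (v i $ b)) * w $ (b, m))"
      by (simp add: sum_distrib_left sum_distrib_right mult_ac) (rule sum.swap)
    then show ?thesis
      by (simp add: onb_complete[OF assms] of_bool_def if_distrib[of "\<lambda>x. x * _"] cong: if_cong)
  qed
  then show ?thesis
    by (simp add: vec_eq_iff vtensor_def slice_def)
qed

lemma mult_vec_sum_right: "A *v (\<Sum>i\<in>S. f i) = (\<Sum>i\<in>S. A *v (f i :: complex^'n))"
  by (induction S rule: infinite_finite_induct) (simp_all add: matrix_vector_right_distrib)

text \<open>Along an eigenbasis of \<open>A\<close> the tensor product is block diagonal with blocks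
  \<open>x i\<close> times \<open>B\<close>, which reduces comparisons to the second factor.\<close>

lemma qf_tensor:
  assumes "onb v" "\<And>i. A *v v i = complex_of_real (x i) *s v i"
  shows "qf (A \<otimes> B) w = (\<Sum>i\<in>UNIV. x i * qf B (slice (v i) w))"
proof -
  have "(A \<otimes> B) *v w = (A \<otimes> B) *v (\<Sum>i\<in>UNIV. vtensor (v i) (slice (v i) w))"
    by (simp add: vtensor_slice_decomp[OF assms(1)])
  also have "\<dots> = (\<Sum>i\<in>UNIV. complex_of_real (x i) *s vtensor (v i) (B *v slice (v i) w))"
    by (simp add: mult_vec_sum_right tensor_mult_vtensor assms(2) vtensor_scale_left)
  finally show ?thesis
    by (simp add: qf_def cip_sum_right cip_scale_right cip_vtensor_right)
qed

lemma qf_one: "qf (mat 1) w = (norm w)\<^sup>2"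
  by (simp add: qf_def cip_self)

lemma sum_slice_norm:
  assumes "onb v"
  shows "(\<Sum>i\<in>UNIV. (norm (slice (v i) w))\<^sup>2) = (norm w)\<^sup>2"
proof -
  have "cip w w = cip w (\<Sum>i\<in>UNIV. vtensor (v i) (slice (v i) w))"
    by (simp add: vtensor_slice_decomp[OF assms])
  also have "\<dots> = complex_of_real (\<Sum>i\<in>UNIV. (norm (slice (v i) w))\<^sup>2)"
    by (simp add: cip_sum_right cip_vtensor_right cip_self)
  finally show ?thesis
    unfolding cip_self using of_real_eq_iff by metis
qed

lemma qf_add: "qf (A + B) w = qf A w + qf B w"
  by (simp add: qf_def matrix_vector_mult_add_rdistrib cip_add_right)

lemma qf_scaleR: "qf (c *\<^sub>R A) w = c * qf A w"
proof -
  have "(c *\<^sub>R A) *v w = complex_of_real c *s (A *v w)"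
    by (simp add: vec_eq_iff matrix_vector_mult_def sum_distrib_left)
      (simp add: scaleR_conv_of_real mult_ac)
  then show ?thesis
    by (simp add: qf_def cip_scale_right)
qed

section \<open>Reduction criterion for separable states\<close>

lemma reduce_fst_add: "reduce_fst (A + B) = reduce_fst A + reduce_fst B"
  by (simp add: reduce_fst_def vec_eq_iff sum.distrib)

lemma reduce_fst_scaleR: "reduce_fst (c *\<^sub>R A) = c *\<^sub>R reduce_fst A"
  by (simp add: reduce_fst_def vec_eq_iff scaleR_sum_right)

lemma reduce_fst_tensor: "reduce_fst (A \<otimes> B) = (\<chi> i j. A $ i $ j * trace B)"
  by (simp add: reduce_fst_def vec_eq_iff tensor_def trace_def sum_distrib_left)

lemma tensor_add_left: "(A + B) \<otimes> C = A \<otimes> C + B \<otimes> C"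
  by (simp add: tensor_def vec_eq_iff algebra_simps)

lemma tensor_scaleR_left: "(c *\<^sub>R A) \<otimes> C = c *\<^sub>R (A \<otimes> C)"
  by (simp add: tensor_def vec_eq_iff)

text \<open>The reduction criterion \<open>\<rho> \<le> \<rho>\<^sub>1 \<otimes> I\<close>, which is the only consequence of separability
  that the bound uses.\<close>

lemma separable_reduction:
  assumes "separable \<rho>"
  shows "qf \<rho> w \<le> qf (reduce_fst \<rho> \<otimes> mat 1) w"
proof -
  \<comment> \<open>Both sides are linear in \<open>\<rho>\<close> for fixed \<open>w\<close>, so
    the set is convex and product states suffice.\<close>
  let ?R = "{\<rho> :: complex^('a \<times> 'b)^('a \<times> 'b). qf \<rho> w \<le> qf (reduce_fst \<rho> \<otimes> mat 1) w}"
  have "convex ?R"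
    by (rule convexI)
      (auto simp: qf_add qf_scaleR reduce_fst_add reduce_fst_scaleR tensor_add_left
        tensor_scaleR_left intro!: add_mono mult_left_mono)
  moreover have "\<sigma> \<otimes> \<tau> \<in> ?R" if "state \<sigma>" "state \<tau>" for \<sigma> :: "complex^'a^'a" and \<tau> :: "complex^'b^'b"
  proof -
    have psd: "psd \<sigma>" "psd \<tau>" and tr: "trace \<tau> = 1"
      using that by (auto simp: state_def)
    obtain v x where vx: "onb v" "\<And>i. \<sigma> *v v i = complex_of_real (x i) *s v i"
      using hermitian_eigenbasis psd(1) by (metis psd_def)
    have "reduce_fst (\<sigma> \<otimes> \<tau>) = \<sigma>"
      by (simp add: reduce_fst_tensor tr vec_eq_iff)
    moreover have "qf (\<sigma> \<otimes> \<tau>) w \<le> qf (\<sigma> \<otimes> mat 1) w"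
      unfolding qf_tensor[OF vx] qf_one
      using psd_qf_le_trace[OF psd(2)] psd_eigenvalue_nonneg[OF psd(1) vx]
      by (intro sum_mono mult_left_mono) (auto simp: tr)
    ultimately show ?thesis by simp
  qed
  ultimately have "convex hull {\<sigma> \<otimes> \<tau> | \<sigma> \<tau>. state \<sigma> \<and> state \<tau>} \<subseteq> ?R"
    by (intro hull_minimal) auto
  with assms show ?thesis
    by (auto simp: separable_def)
qed

section \<open>Majorization of a separable state by its marginal\<close>

lemma slice_nth: "slice u w $ m = cip (vtensor u (axis m 1)) w"
  by (simp add: cip_vtensor_left) (simp add: cip_def axis_def if_distrib[of "\<lambda>x. x * _"] if_distrib[of cnj] cong: if_cong)

text \<open>The partial trace, evaluated in the computational basis of the second factor.\<close>

lemma sum_qf_vtensor_axis: "(\<Sum>m\<in>UNIV. qf \<rho> (vtensor u (axis m 1))) = qf (reduce_fst \<rho>) u"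
proof -
  have "cip (vtensor u (axis m 1)) (\<rho> *v vtensor u (axis m 1)) =
      (\<Sum>a\<in>UNIV. \<Sum>b\<in>UNIV. cnj (u $ a) * \<rho> $ (a, m) $ (b, m) * u $ b)" for m
    by (simp add: cip_def vtensor_def matrix_vector_mult_def sum_UNIV_prod axis_def
        if_distrib[of "\<lambda>x. x * _"] if_distrib[of "\<lambda>x. _ * x"] if_distrib[of cnj]
        sum_distrib_left mult_ac cong: if_cong)
      (rule sum.cong[OF refl], subst sum.swap, simp)
  then have "(\<Sum>m\<in>UNIV. cip (vtensor u (axis m 1)) (\<rho> *v vtensor u (axis m 1))) =
      (\<Sum>a\<in>UNIV. \<Sum>b\<in>UNIV. \<Sum>m\<in>UNIV. cnj (u $ a) * \<rho> $ (a, m) $ (b, m) * u $ b)"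
    by simp (subst sum.swap, rule sum.cong[OF refl], rule sum.swap)
  also have "\<dots> = cip u (reduce_fst \<rho> *v u)"
    by (simp add: cip_def matrix_vector_mult_def reduce_fst_def sum_distrib_left sum_distrib_right
        mult_ac)
  finally show ?thesis
    by (simp add: qf_def flip: Re_sum)
qed

lemma norm_slice_sq: "(norm (slice u w))\<^sup>2 = (\<Sum>m\<in>UNIV. (cmod (cip (vtensor u (axis m 1)) w))\<^sup>2)"
  by (simp add: norm_vec_def L2_set_def sum_nonneg slice_nth)

lemma cmod_cip_commute: "cmod (cip u v) = cmod (cip v u)"
  by (metis cnj_cip complex_mod_cnj)

text \<open>At an eigenvector \<open>u\<close> of the marginal the value is its eigenvalue; this
  supplies the column sums of \<open>D\<close> in \<open>separable_diag_sum_le\<close>.\<close>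

lemma sum_eigen_slice:
  assumes "onb e" "\<And>l. \<rho> *v e l = complex_of_real (p l) *s e l"
  shows "(\<Sum>l\<in>UNIV. p l * (norm (slice u (e l)))\<^sup>2) = qf (reduce_fst \<rho>) u"
proof -
  have "(\<Sum>l\<in>UNIV. p l * (norm (slice u (e l)))\<^sup>2) =
      (\<Sum>m\<in>UNIV. \<Sum>l\<in>UNIV. p l * (cmod (cip (e l) (vtensor u (axis m 1))))\<^sup>2)"
    by (subst sum.swap)
      (simp add: norm_slice_sq sum_distrib_left cmod_cip_commute[of "vtensor u _"])
  then show ?thesis
    by (simp add: qf_eigen[OF assms, symmetric] sum_qf_vtensor_axis)
qed

lemma slice_vtensor:
  assumes "onb v"
  shows "slice (v i) (\<Sum>j\<in>UNIV. vtensor (complex_of_real (c j) *s v j) (z j)) = complex_of_real (c i) *s z i"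
proof -
  have "slice (v i) (\<Sum>j\<in>UNIV. vtensor (complex_of_real (c j) *s v j) (z j)) $ m =
      (\<Sum>j\<in>UNIV. complex_of_real (c j) * cip (v i) (v j) * z j $ m)" for m
    by (simp add: slice_def vtensor_def cip_def sum_distrib_left sum_distrib_right mult_ac)
      (rule sum.swap)
  then show ?thesis
    using assms by (simp add: vec_eq_iff onb_def of_bool_def if_distrib[of "\<lambda>x. x * _"]
        if_distrib[of "\<lambda>x. _ * x"] cong: if_cong)
qed

text \<open>With \<open>Y\<close> the pseudo-inverse of \<open>\<rho>\<^sub>1 \<otimes> I\<close>, the reduction criterion at the vector
  \<open>Y e\<close> reads \<open>p (e \<cdot> Y e)\<^sup>2 \<le> e \<cdot> Y e\<close>; division by zero realizes the pseudo-inverse.\<close>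

lemma reduction_row_sum:
  fixes \<rho> :: "complex^('a::finite \<times> 'b::finite)^('a \<times> 'b)"
  assumes psd: "psd \<rho>" and red: "\<And>w. qf \<rho> w \<le> qf (reduce_fst \<rho> \<otimes> mat 1) w"
    and e: "onb e" "\<And>l. \<rho> *v e l = complex_of_real (p l) *s e l"
    and v: "onb v" "\<And>i. reduce_fst \<rho> *v v i = complex_of_real (x i) *s v i"
    and x0: "\<And>i. x i \<ge> 0"
  shows "(\<Sum>i\<in>UNIV. p l / x i * (norm (slice (v i) (e l)))\<^sup>2) \<le> 1"
proof -
  define n where "n i = (norm (slice (v i) (e l)))\<^sup>2" for i
  define s where "s = (\<Sum>i\<in>UNIV. n i / x i)"
  define w where "w = (\<Sum>i\<in>UNIV. vtensor (complex_of_real (1 / x i) *s v i) (slice (v i) (e l)))"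
  have p0: "p k \<ge> 0" for k
    by (rule psd_eigenvalue_nonneg[OF psd e])
  have s0: "s \<ge> 0"
    by (auto simp: s_def n_def x0 intro!: sum_nonneg)
  have "cip (e l) w = complex_of_real s"
    by (simp add: w_def s_def n_def cip_sum_right vtensor_scale_left cip_scale_right
        cip_vtensor_right cip_self)
  then have "p l * s\<^sup>2 = p l * (cmod (cip (e l) w))\<^sup>2"
    by simp
  \<comment> \<open>\<open>\<rho>\<close> dominates its single spectral term
    \<open>p l |e l><e l|\<close>.\<close>
  also have "\<dots> \<le> (\<Sum>k\<in>UNIV. p k * (cmod (cip (e k) w))\<^sup>2)"
    by (rule member_le_sum) (auto simp: p0)
  also have "\<dots> = qf \<rho> w"
    by (simp add: qf_eigen[OF e])
  also have "\<dots> \<le> qf (reduce_fst \<rho> \<otimes> mat 1) w"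
    by (rule red)
  also have "\<dots> = (\<Sum>i\<in>UNIV. x i * (norm (complex_of_real (1 / x i) *s slice (v i) (e l)))\<^sup>2)"
    unfolding qf_tensor[OF v] qf_one by (simp only: w_def slice_vtensor[OF v(1)])
  also have "\<dots> = s"
    unfolding s_def n_def using x0
    by (intro sum.cong refl)
      (auto simp: norm_scale_complex norm_divide power_mult_distrib power2_eq_square)
  finally have "p l * s\<^sup>2 \<le> s" .
  then have "p l * s \<le> 1"
    using s0 by (cases "s = 0") (auto simp: power2_eq_square)
  then show ?thesis
    by (simp add: s_def n_def sum_distrib_left)
qed

text \<open>Measured from the threshold \<open>c\<close>, entries in \<open>B\<close> contribute at
  most their full excess and the others nothing positive; \<open>0 \<le> c\<close> covers a total
  weight below \<open>card B\<close>.\<close>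

lemma weighted_sum_le_top:
  fixes x d :: "'i::finite \<Rightarrow> real"
  assumes "\<And>i. 0 \<le> d i" "\<And>i. d i \<le> 1" "(\<Sum>i\<in>UNIV. d i) \<le> card B" "0 \<le> c"
    and "\<And>i. i \<in> B \<Longrightarrow> c \<le> x i" "\<And>i. i \<notin> B \<Longrightarrow> x i \<le> c"
  shows "(\<Sum>i\<in>UNIV. d i * x i) \<le> (\<Sum>i\<in>B. x i)"
proof -
  have "d i * (x i - c) \<le> (if i \<in> B then x i - c else 0)" for i
    using assms(1,2)[of i] assms(5,6)[of i]
    by (auto simp: mult_nonneg_nonpos mult_left_le_one_le)
  then have "(\<Sum>i\<in>UNIV. d i * (x i - c)) \<le> (\<Sum>i\<in>UNIV. if i \<in> B then x i - c else 0)"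
    by (rule sum_mono)
  also have "\<dots> = (\<Sum>i\<in>B. x i) - card B * c"
    by (simp add: sum.If_cases sum_subtractf)
  finally have "(\<Sum>i\<in>UNIV. d i * x i) - (\<Sum>i\<in>UNIV. d i) * c \<le> (\<Sum>i\<in>B. x i) - card B * c"
    by (simp add: algebra_simps sum_subtractf sum_distrib_left)
  moreover have "(\<Sum>i\<in>UNIV. d i) * c \<le> card B * c"
    using assms by (intro mult_right_mono) auto
  ultimately show ?thesis by linarith
qed

text \<open>The spectrum of the reduced state majorizes that of the separable state
  (Nielsen and Kempe), as bounds on partial sums of diagonal entries.\<close>

lemma separable_diag_sum_le:
  fixes \<rho> :: "complex^('a::finite \<times> 'b::finite)^('a \<times> 'b)"
  assumes psd: "psd \<rho>" and sep: "separable \<rho>"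
    and v: "onb v" "\<And>i. reduce_fst \<rho> *v v i = complex_of_real (x i) *s v i"
    and f: "onb f" and card: "card A \<le> card B"
    and c: "0 \<le> c" "\<And>i. i \<in> B \<Longrightarrow> c \<le> x i" "\<And>i. i \<notin> B \<Longrightarrow> x i \<le> c"
  shows "(\<Sum>k\<in>A. qf \<rho> (f k)) \<le> (\<Sum>i\<in>B. x i)"
proof -
  obtain e p where e: "onb e" "\<And>l. \<rho> *v e l = complex_of_real (p l) *s e l"
    using hermitian_eigenbasis psd by (metis psd_def)
  note red = separable_reduction[OF sep]
  have p0: "p k \<ge> 0" for k
    by (rule psd_eigenvalue_nonneg[OF psd e])
  have sum_n: "(\<Sum>l\<in>UNIV. p l * (norm (slice (v i) (e l)))\<^sup>2) = x i" for i
    by (simp add: sum_eigen_slice[OF e] eigenvalue_eq_qf[OF v])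
  have x0: "x i \<ge> 0" for i
    unfolding sum_n[symmetric] by (intro sum_nonneg) (simp add: p0)
  \<comment> \<open>\<open>D\<close> carries the spectrum \<open>x\<close> to \<open>p\<close>, and
    the overlaps \<open>S\<close> carry \<open>p\<close> to the diagonal in the basis
    \<open>f\<close>. Thus \<open>d i\<close> is the total weight with which \<open>x i\<close>
    enters the sum over \<open>A\<close>.\<close>
  define D where "D l i = p l / x i * (norm (slice (v i) (e l)))\<^sup>2" for l i
  define S where "S k l = (cmod (cip (f k) (e l)))\<^sup>2" for k l
  define d where "d i = (\<Sum>k\<in>A. \<Sum>l\<in>UNIV. S k l * D l i)" for i
  have D0: "D l i \<ge> 0" for l i
    by (simp add: D_def p0 x0)
  have S0: "S k l \<ge> 0" for k l
    by (simp add: S_def)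
  have D_row: "(\<Sum>i\<in>UNIV. D l i) \<le> 1" for l
    unfolding D_def by (rule reduction_row_sum[OF psd red e v x0])
  have D_col: "(\<Sum>l\<in>UNIV. D l i) \<le> 1" for i
  proof -
    have "(\<Sum>l\<in>UNIV. D l i) = (\<Sum>l\<in>UNIV. p l * (norm (slice (v i) (e l)))\<^sup>2) / x i"
      by (simp add: D_def sum_divide_distrib)
    \<comment> \<open>The quotient is 1, or 0 if \<open>x i = 0\<close>; it is at most 1 either
      way.\<close>
    also have "\<dots> = x i / x i"
      by (simp only: sum_n)
    finally have "(\<Sum>l\<in>UNIV. D l i) = x i / x i" .
    then show ?thesis by simp
  qed
  have D_mult: "(\<Sum>i\<in>UNIV. D l i * x i) = p l" for l
  proof -
    have "D l i * x i = p l * (norm (slice (v i) (e l)))\<^sup>2" for i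
    proof (cases "x i = 0")
      \<comment> \<open>The nonnegative terms of a column with sum zero all vanish, so the
        pseudo-inverse loses nothing.\<close>
      case True
      then have "(\<Sum>l\<in>UNIV. p l * (norm (slice (v i) (e l)))\<^sup>2) = 0"
        by (simp only: sum_n)
      then have "\<forall>l\<in>UNIV. p l * (norm (slice (v i) (e l)))\<^sup>2 = 0"
        by (subst (asm) sum_nonneg_eq_0_iff) (auto simp: p0)
      then have "p l * (norm (slice (v i) (e l)))\<^sup>2 = 0"
        by blast
      then show ?thesis using True by simp
    qed (simp add: D_def)
    then show ?thesis
      by (simp add: sum_slice_norm[OF v(1)] onb_norm[OF e(1)] flip: sum_distrib_left)
  qed
  have S_row: "(\<Sum>l\<in>UNIV. S k l) = 1" for k
    unfolding S_def cmod_cip_commute[of "f k"]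
    by (simp add: onb_parseval[OF e(1)] onb_norm[OF f])
  have S_col: "(\<Sum>k\<in>A. S k l) \<le> 1" for l
  proof -
    have "(\<Sum>k\<in>A. S k l) \<le> (\<Sum>k\<in>UNIV. S k l)"
      by (intro sum_mono2) (auto simp: S0)
    then show ?thesis
      by (simp add: S_def onb_parseval[OF f] onb_norm[OF e(1)])
  qed
  have d_eq: "d i = (\<Sum>l\<in>UNIV. (\<Sum>k\<in>A. S k l) * D l i)" for i
    unfolding d_def by (subst sum.swap) (simp add: sum_distrib_right)
  have "d i \<le> (\<Sum>l\<in>UNIV. 1 * D l i)" for i
    unfolding d_eq by (intro sum_mono mult_right_mono S_col D0)
  then have d1: "d i \<le> 1" for i
    using D_col[of i] order_trans by fastforce
  have "(\<Sum>i\<in>UNIV. d i) = (\<Sum>k\<in>A. \<Sum>l\<in>UNIV. S k l * (\<Sum>i\<in>UNIV. D l i))"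
    unfolding d_def sum_distrib_left
    by (subst sum.swap, rule sum.cong[OF refl], rule sum.swap)
  also have "\<dots> \<le> (\<Sum>k\<in>A. \<Sum>l\<in>UNIV. S k l * 1)"
    by (intro sum_mono mult_left_mono D_row S0)
  also have "\<dots> = card A"
    by (simp add: S_row)
  finally have d_sum: "(\<Sum>i\<in>UNIV. d i) \<le> card B"
    using card by linarith
  have "qf \<rho> (f k) = (\<Sum>l\<in>UNIV. S k l * p l)" for k
    by (simp add: qf_eigen[OF e] S_def cmod_cip_commute[of "f k"] mult.commute)
  then have "(\<Sum>k\<in>A. qf \<rho> (f k)) = (\<Sum>k\<in>A. \<Sum>l\<in>UNIV. \<Sum>i\<in>UNIV. S k l * D l i * x i)"
    by (simp add: sum_distrib_left mult.assoc flip: D_mult)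
  also have "\<dots> = (\<Sum>i\<in>UNIV. d i * x i)"
    unfolding d_def sum_distrib_right
    by (subst (3) sum.swap, rule sum.cong[OF refl], rule sum.swap)
  also have "\<dots> \<le> (\<Sum>i\<in>B. x i)"
    using d1 d_sum c by (intro weighted_sum_le_top) (auto simp: d_def S0 D0 intro!: sum_nonneg)
  finally show ?thesis .
qed

section \<open>Traces, diagonal Hamiltonians and energy levels\<close>

lemma onb_trace:
  assumes "dagger A = A" "onb f"
  shows "(\<Sum>k\<in>UNIV. qf A (f k)) = Re (trace A)"
proof -
  obtain e p where e: "onb e" "\<And>l. A *v e l = complex_of_real (p l) *s e l"
    using hermitian_eigenbasis[OF assms(1)] by blast
  have "(\<Sum>k\<in>UNIV. qf A (f k)) = (\<Sum>l\<in>UNIV. \<Sum>k\<in>UNIV. p l * (cmod (cip (f k) (e l)))\<^sup>2)"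
    unfolding qf_eigen[OF e] cmod_cip_commute[of "e _"] by (rule sum.swap)
  then show ?thesis
    by (simp add: onb_parseval[OF assms(2)] onb_norm[OF e(1)] trace_eigen[OF e]
        flip: sum_distrib_left)
qed

lemma onb_reindex: "onb v \<Longrightarrow> inj g \<Longrightarrow> onb (v \<circ> g)"
  by (auto simp: onb_def inj_def)

lemma trace_reduce_fst: "trace (reduce_fst \<rho>) = trace \<rho>"
  by (simp add: trace_def reduce_fst_def sum_UNIV_prod)

lemma dagger_reduce_fst: "dagger \<rho> = \<rho> \<Longrightarrow> dagger (reduce_fst \<rho>) = reduce_fst \<rho>"
  by (simp add: vec_eq_iff dagger_def map_matrix_def transpose_def reduce_fst_def)

lemma energy_diag:
  assumes "\<And>i j. K $ i $ j = (if i = j then complex_of_real (k i) else 0)"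
  shows "energy K \<sigma> = (\<Sum>i\<in>UNIV. k i * Re (\<sigma> $ i $ i))"
  by (simp add: energy_def trace_def matrix_matrix_mult_def assms if_distrib[of "\<lambda>x. _ * x"]
      mult.commute cong: if_cong)

lemma energy_diag_conj:
  assumes "\<And>i j. K $ i $ j = (if i = j then complex_of_real (k i) else 0)"
  shows "energy K (U ** \<sigma> ** dagger U) =
    (\<Sum>i\<in>UNIV. k i * qf \<sigma> (\<chi> j. cnj (U $ i $ j)))"
  by (simp add: energy_diag[OF assms] conj_unitary_diag qf_def)

lemma bit_cases: "(i :: 2) = 0 \<or> i = 1"
  using exhaust_2[of i] by auto

lemma UNIV_bit: "(UNIV :: 2 set) = {0, 1}"
  using bit_cases by auto

definition level :: "real \<Rightarrow> real \<Rightarrow> 2 \<Rightarrow> real" where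
  "level e a i = (if i = 0 then e else e + a)"

lemma qubit_ham_nth:
  "qubit_ham e a $ i $ j = (if i = j then complex_of_real (level e a i) else 0)"
  using bit_cases[of i] bit_cases[of j]
  by (auto simp: qubit_ham_def ketbra_def level_def scaleR_conv_of_real[where 'a = complex])

lemma ham12_nth:
  "ham12 E \<alpha> $ i $ j = (if i = j then
     complex_of_real (level (E 1) (\<alpha> 1) (fst i) + level (E 2) (\<alpha> 2) (snd i)) else 0)"
  by (auto simp: ham12_def tensor_def qubit_ham_nth mat_def prod_eq_iff)

lemma ham123_nth:
  "ham123 E \<alpha> $ i $ j = (if i = j then
     complex_of_real (level (E 1) (\<alpha> 1) (fst (fst i)) + level (E 2) (\<alpha> 2) (snd (fst i)) +
       level (E 3) (\<alpha> 3) (snd i)) else 0)"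
  by (auto simp: ham123_def tensor_def qubit_ham_nth mat_def prod_eq_iff)

text \<open>Each summand of the Hamiltonian acts on one side of the bipartition, so only the
  marginals enter. This cancels the mean energies in \<open>gap_12_3\<close>.\<close>

lemma energy_ham123:
  "energy (ham123 E \<alpha>) \<rho> =
    energy (ham12 E \<alpha>) (reduce_fst \<rho>) + energy (qubit_ham (E 3) (\<alpha> 3)) (reduce_snd \<rho>)"
  unfolding energy_diag[OF ham123_nth] energy_diag[OF ham12_nth] energy_diag[OF qubit_ham_nth]
  by (simp add: sum_UNIV_prod UNIV_bit reduce_fst_def reduce_snd_def algebra_simps)

lemma UNIV_two_bits: "(UNIV :: (2 \<times> 2) set) = {(0, 0), (1, 0), (0, 1), (1, 1)}"
  using bit_cases by auto

section \<open>Passive energies and the bound on the gap\<close>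

text \<open>The labels are listed by increasing energy of qubits 1 and 2 for
  \<open>\<alpha> 1 \<le> \<alpha> 2\<close>, so decreasing populations on them form the passive
  arrangement.\<close>

lemma exists_sorting_permutation:
  fixes x :: "2 \<times> 2 \<Rightarrow> real"
  shows "\<exists>g :: 2 \<times> 2 \<Rightarrow> 2 \<times> 2. inj g \<and> x (g (0, 0)) \<ge> x (g (1, 0)) \<and> x (g (1, 0)) \<ge> x (g (0, 1)) \<and>
    x (g (0, 1)) \<ge> x (g (1, 1))"
proof -
  define ls where "ls = sort_key (\<lambda>i. - x i) [(0, 0), (1, 0), (0, 1), (1, 1)]"
  have "length ls = 4"
    by (simp add: ls_def)
  then obtain a b c d where ls: "ls = [a, b, c, d]"
    by (auto simp: numeral_eq_Suc length_Suc_conv)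
  have "sorted (map (\<lambda>i. - x i) ls)"
    unfolding ls_def by (rule sorted_sort_key)
  moreover have "distinct ls"
    by (simp add: ls_def)
  ultimately show ?thesis
    by (intro exI[of _ "\<lambda>p. if p = (0, 0) then a else if p = (1, 0) then b
            else if p = (0, 1) then c else d"])
      (auto simp: ls inj_on_def UNIV_two_bits)
qed

text \<open>Reduces the problem to real arithmetic: \<open>x\<close> is the ordered spectrum of the
  marginal, and \<open>r\<close> holds the level populations of \<open>\<rho>\<close> after an
  optimal unitary. Majorization enters through one and two levels.\<close>

lemma gap_le_occupations:
  assumes "state \<rho>" "separable \<rho>"
  obtains x :: "2 \<times> 2 \<Rightarrow> real" and r :: "(2 \<times> 2) \<times> 2 \<Rightarrow> real"
  where "x (0, 0) + x (1, 0) + x (0, 1) + x (1, 1) = 1"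
    "x (0, 0) \<ge> x (1, 0)" "x (1, 0) \<ge> x (0, 1)" "x (0, 1) \<ge> x (1, 1)" "x (1, 1) \<ge> 0"
    "\<And>k. r k \<ge> 0" "(\<Sum>k\<in>UNIV. r k) = 1" "\<And>k. r k \<le> x (0, 0)"
    "\<And>k l. k \<noteq> l \<Longrightarrow> r k + r l \<le> x (0, 0) + x (1, 0)"
    "gap_12_3 E \<alpha> \<rho> \<le> x (1, 0) * \<alpha> 1 + x (0, 1) * \<alpha> 2 + x (1, 1) * (\<alpha> 1 + \<alpha> 2) -
      (\<Sum>k\<in>UNIV. (level 0 (\<alpha> 1) (fst (fst k)) + level 0 (\<alpha> 2) (snd (fst k)) +
         level 0 (\<alpha> 3) (snd k)) * r k)"
proof -
  have psd: "psd \<rho>" and herm: "dagger \<rho> = \<rho>" and tr: "trace \<rho> = 1"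
    using assms(1) by (auto simp: state_def psd_def)
  note hermr = dagger_reduce_fst[OF herm]
  obtain v0 x0 where v0: "onb v0"
    "\<And>i. reduce_fst \<rho> *v v0 i = complex_of_real (x0 i) *s v0 i"
    using hermitian_eigenbasis[OF hermr] by blast
  obtain g :: "2 \<times> 2 \<Rightarrow> 2 \<times> 2" where g: "inj g \<and> x0 (g (0, 0)) \<ge> x0 (g (1, 0)) \<and>
      x0 (g (1, 0)) \<ge> x0 (g (0, 1)) \<and> x0 (g (0, 1)) \<ge> x0 (g (1, 1))"
    using exists_sorting_permutation[of x0] ..
  define v where "v = v0 \<circ> g"
  define x where "x = x0 \<circ> g"
  have v: "onb v" "\<And>i. reduce_fst \<rho> *v v i = complex_of_real (x i) *s v i"
    using v0 onb_reindex[OF v0(1) conjunct1[OF g]] by (auto simp: v_def x_def)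
  have ord: "x (0, 0) \<ge> x (1, 0)" "x (1, 0) \<ge> x (0, 1)" "x (0, 1) \<ge> x (1, 1)"
    using g by (auto simp: x_def)
  have sum_x: "x (0, 0) + x (1, 0) + x (0, 1) + x (1, 1) = 1"
  proof -
    have "complex_of_real (\<Sum>i\<in>UNIV. x i) = 1"
      using trace_eigen[OF v] by (simp only: trace_reduce_fst tr)
    then have "(\<Sum>i\<in>UNIV. x i) = 1"
      by (simp only: of_real_eq_1_iff)
    then show ?thesis
      by (simp add: UNIV_two_bits)
  qed
  have x_nonneg: "x i \<ge> 0" for i
  proof -
    have "x i = (\<Sum>m\<in>UNIV. qf \<rho> (vtensor (v i) (axis m 1)))"
      by (simp add: eigenvalue_eq_qf[OF v] sum_qf_vtensor_axis)
    then show ?thesis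
      using psd by (simp add: psd_iff sum_nonneg)
  qed
  obtain U where U: "unitary U"
    "ergotropy (ham123 E \<alpha>) \<rho> = energy (ham123 E \<alpha>) \<rho> - energy (ham123 E \<alpha>) (U ** \<rho> ** dagger U)"
    using ergotropy_minimum[of "ham123 E \<alpha>" \<rho>] by metis
  define f where "f k = (\<chi> j. cnj (U $ k $ j))" for k
  define r where "r k = qf \<rho> (f k)" for k
  have f: "onb f"
    using unitary_onb[OF U(1)] by (simp add: f_def[abs_def])
  have r0: "r k \<ge> 0" for k
    using psd by (simp add: r_def psd_iff)
  have sum_r: "(\<Sum>k\<in>UNIV. r k) = 1"
    by (simp add: r_def onb_trace[OF herm f] tr)
  have r1: "r k \<le> x (0, 0)" for k
  proof -
    have "x i \<le> x (0, 0)" for i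
      using ord by (cases i) (use bit_cases[of "fst i"] bit_cases[of "snd i"] in auto)
    then show ?thesis
      using separable_diag_sum_le[OF psd assms(2) v f, of "{k}" "{(0, 0)}" "x (0, 0)"]
      by (simp add: r_def x_nonneg)
  qed
  have r2: "r k + r l \<le> x (0, 0) + x (1, 0)" if "k \<noteq> l" for k l
  proof -
    have "i \<notin> {(0, 0), (1, 0)} \<Longrightarrow> x i \<le> x (1, 0)" for i
      using ord by (cases i) (use bit_cases[of "fst i"] bit_cases[of "snd i"] in auto)
    then show ?thesis
      using separable_diag_sum_le[OF psd assms(2) v f, of "{k, l}" "{(0, 0), (1, 0)}" "x (1, 0)"]
        that ord(1) by (auto simp: r_def x_nonneg)
  qed
  \<comment> \<open>An upper bound on the gap takes only a lower bound on the marginal's ergotropy,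
    so one unitary is enough: the rotation to the sorted eigenbasis.\<close>
  define V :: "complex^(2 \<times> 2)^(2 \<times> 2)" where "V = (\<chi> i j. cnj (v i $ j))"
  have "unitary V"
    unfolding V_def by (rule onb_unitary[OF v(1)])
  then have erg12: "ergotropy (ham12 E \<alpha>) (reduce_fst \<rho>) \<ge>
      energy (ham12 E \<alpha>) (reduce_fst \<rho>) - energy (ham12 E \<alpha>) (V ** reduce_fst \<rho> ** dagger V)"
    using ergotropy_minimum[of "ham12 E \<alpha>" "reduce_fst \<rho>"] by (metis diff_left_mono)
  have "energy (ham12 E \<alpha>) (V ** reduce_fst \<rho> ** dagger V) =
      (\<Sum>i\<in>UNIV. (level (E 1) (\<alpha> 1) (fst i) + level (E 2) (\<alpha> 2) (snd i)) * x i)"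
    unfolding energy_diag_conj[OF ham12_nth] by (simp add: V_def eigenvalue_eq_qf[OF v])
  also have "\<dots> = (E 1 + E 2) * (x (0, 0) + x (1, 0) + x (0, 1) + x (1, 1)) +
      x (1, 0) * \<alpha> 1 + x (0, 1) * \<alpha> 2 + x (1, 1) * (\<alpha> 1 + \<alpha> 2)"
    by (simp add: UNIV_two_bits level_def algebra_simps)
  finally have p12: "energy (ham12 E \<alpha>) (V ** reduce_fst \<rho> ** dagger V) =
      E 1 + E 2 + x (1, 0) * \<alpha> 1 + x (0, 1) * \<alpha> 2 + x (1, 1) * (\<alpha> 1 + \<alpha> 2)"
    by (simp only: sum_x mult_1_right)
  have "energy (ham123 E \<alpha>) (U ** \<rho> ** dagger U) =
      (\<Sum>k\<in>UNIV. (level (E 1) (\<alpha> 1) (fst (fst k)) + level (E 2) (\<alpha> 2) (snd (fst k)) +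
         level (E 3) (\<alpha> 3) (snd k)) * r k)"
    unfolding energy_diag_conj[OF ham123_nth] by (simp add: r_def f_def)
  \<comment> \<open>The offset splits off because \<open>r\<close> sums to one;
    \<open>E 1 + E 2\<close> then cancels against \<open>p12\<close> and \<open>E 3\<close> against
    the last summand of \<open>gap_12_3\<close>.\<close>
  also have "\<dots> = (\<Sum>k\<in>UNIV. (E 1 + E 2 + E 3) * r k +
      (level 0 (\<alpha> 1) (fst (fst k)) + level 0 (\<alpha> 2) (snd (fst k)) + level 0 (\<alpha> 3) (snd k)) * r k)"
    by (rule sum.cong) (auto simp: level_def algebra_simps)
  also have "\<dots> = E 1 + E 2 + E 3 + (\<Sum>k\<in>UNIV. (level 0 (\<alpha> 1) (fst (fst k)) +
      level 0 (\<alpha> 2) (snd (fst k)) + level 0 (\<alpha> 3) (snd k)) * r k)"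
    by (simp add: sum.distrib sum_r flip: sum_distrib_left)
  finally have "gap_12_3 E \<alpha> \<rho> \<le> x (1, 0) * \<alpha> 1 + x (0, 1) * \<alpha> 2 + x (1, 1) * (\<alpha> 1 + \<alpha> 2) -
      (\<Sum>k\<in>UNIV. (level 0 (\<alpha> 1) (fst (fst k)) + level 0 (\<alpha> 2) (snd (fst k)) +
         level 0 (\<alpha> 3) (snd k)) * r k)"
    using erg12 unfolding gap_12_3_def U(2) p12 energy_ham123[of E \<alpha> \<rho>] by linarith
  with sum_x ord x_nonneg r0 sum_r r1 r2 show ?thesis
    by (intro that[of x r]) auto
qed

text \<open>Lumping the higher levels at \<open>b\<close> and summing by parts bounds the energy
  below by \<open>b - (b - a) * (r k + r l) - a * r k\<close>. In both applications the third and
  fourth lowest levels coincide at \<open>b\<close>.\<close>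

lemma two_level_energy_le:
  fixes r d :: "'k::finite \<Rightarrow> real"
  assumes "\<And>j. 0 \<le> r j" "(\<Sum>j\<in>UNIV. r j) = 1" "k \<noteq> l"
    and "d k = 0" "d l = a" "\<And>j. j \<noteq> k \<Longrightarrow> j \<noteq> l \<Longrightarrow> b \<le> d j"
    and "0 \<le> a" "a \<le> b" "r k \<le> s" "r k + r l \<le> t"
  shows "b - (b - a) * t - a * s \<le> (\<Sum>j\<in>UNIV. d j * r j)"
proof -
  have "b * r j - (if j = k then b * r k else 0) - (if j = l then (b - a) * r l else 0) \<le> d j * r j" for j
    using assms(1)[of j] assms(3-6) by (auto simp: algebra_simps mult_right_mono)
  then have "(\<Sum>j\<in>UNIV. b * r j - (if j = k then b * r k else 0) -
      (if j = l then (b - a) * r l else 0)) \<le> (\<Sum>j\<in>UNIV. d j * r j)"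
    by (rule sum_mono)
  then have "b - b * r k - (b - a) * r l \<le> (\<Sum>j\<in>UNIV. d j * r j)"
    by (simp add: sum_subtractf assms(2) flip: sum_distrib_left)
  moreover have "(b - a) * (r k + r l) \<le> (b - a) * t" "a * r k \<le> a * s"
    using assms by (auto intro!: mult_left_mono)
  ultimately show ?thesis by (simp add: algebra_simps)
qed

theorem proposition3:
  fixes E \<alpha> :: "nat \<Rightarrow> real"
    and \<rho> :: "complex^((2 \<times> 2) \<times> 2)^((2 \<times> 2) \<times> 2)"
  assumes "\<forall>i\<in>{1, 2, 3}. \<alpha> i > 0"
    and "state \<rho>"
    and "separable \<rho>"
  shows "(0 < \<alpha> 1 \<and> \<alpha> 1 < \<alpha> 2 \<and> \<alpha> 2 = \<alpha> 3
            \<longrightarrow> gap_12_3 E \<alpha> \<rho> \<le> \<alpha> 1 / 4)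
       \<and> (\<forall>a. \<alpha> 1 = a \<and> \<alpha> 2 = a \<and> a > \<alpha> 3 \<and> \<alpha> 3 > 0 \<and> \<alpha> 3 \<ge> 2 / 3 * a
            \<longrightarrow> gap_12_3 E \<alpha> \<rho> \<le> (a - \<alpha> 3) / 4 + a / 4)
       \<and> (\<forall>a. \<alpha> 1 = a \<and> \<alpha> 2 = a \<and> a > \<alpha> 3 \<and> \<alpha> 3 > 0 \<and> \<alpha> 3 \<le> 2 / 3 * a
            \<longrightarrow> gap_12_3 E \<alpha> \<rho> \<le> (a - \<alpha> 3) / 2 + a / 6)"
proof -
  obtain x :: "2 \<times> 2 \<Rightarrow> real" and r :: "(2 \<times> 2) \<times> 2 \<Rightarrow> real"
    where sum_x: "x (0, 0) + x (1, 0) + x (0, 1) + x (1, 1) = 1"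
    and ord: "x (0, 0) \<ge> x (1, 0)" "x (1, 0) \<ge> x (0, 1)" "x (0, 1) \<ge> x (1, 1)" "x (1, 1) \<ge> 0"
    and r: "\<And>k. r k \<ge> 0" "(\<Sum>k\<in>UNIV. r k) = 1"
    and r1: "\<And>k. r k \<le> x (0, 0)"
    and r2: "\<And>k l. k \<noteq> l \<Longrightarrow> r k + r l \<le> x (0, 0) + x (1, 0)"
    and gap: "gap_12_3 E \<alpha> \<rho> \<le> x (1, 0) * \<alpha> 1 + x (0, 1) * \<alpha> 2 + x (1, 1) * (\<alpha> 1 + \<alpha> 2) -
      (\<Sum>k\<in>UNIV. (level 0 (\<alpha> 1) (fst (fst k)) + level 0 (\<alpha> 2) (snd (fst k)) +
         level 0 (\<alpha> 3) (snd k)) * r k)"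
    using gap_le_occupations[OF assms(2,3), of E \<alpha>] by blast
  let ?d = "\<lambda>k :: (2 \<times> 2) \<times> 2. level 0 (\<alpha> 1) (fst (fst k)) + level 0 (\<alpha> 2) (snd (fst k)) +
    level 0 (\<alpha> 3) (snd k)"
  have pos: "\<alpha> 1 > 0" "\<alpha> 2 > 0" "\<alpha> 3 > 0"
    using assms(1) by auto
  have x00: "x (0, 0) = 1 - x (1, 0) - x (0, 1) - x (1, 1)"
    using sum_x by linarith
  have x11: "x (1, 1) \<le> 1 / 4"
    using sum_x ord by linarith
  have part_a: "gap_12_3 E \<alpha> \<rho> \<le> \<alpha> 1 / 4" if "\<alpha> 1 < \<alpha> 2" "\<alpha> 2 = \<alpha> 3"
  proof -
    \<comment> \<open>The first excitation is that of qubit 1; exciting qubit 2 or qubit 3 alone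
      costs \<open>\<alpha> 2\<close>.\<close>
    have others: "\<alpha> 2 \<le> ?d j" if "j \<noteq> ((0, 0), 0)" "j \<noteq> ((1, 0), 0)" for j
      using that pos \<open>\<alpha> 2 = \<alpha> 3\<close> bit_cases[of "fst (fst j)"] bit_cases[of "snd (fst j)"]
        bit_cases[of "snd j"] by (auto simp: level_def prod_eq_iff)
    have "\<alpha> 2 - (\<alpha> 2 - \<alpha> 1) * (x (0, 0) + x (1, 0)) - \<alpha> 1 * x (0, 0) \<le>
        (\<Sum>k\<in>UNIV. ?d k * r k)"
      using r1 r2 that pos
      by (intro two_level_energy_le[where k = "((0, 0), 0)" and l = "((1, 0), 0)"] r others)
        (auto simp: level_def)
    \<comment> \<open>Only \<open>x (1, 1)\<close> leaves a difference: it costs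
      \<open>\<alpha> 1 + \<alpha> 2\<close> on two qubits, but \<open>\<alpha> 2\<close> as the
      fourth lowest level of three.\<close>
    with gap have "gap_12_3 E \<alpha> \<rho> \<le> \<alpha> 1 * x (1, 1)"
      unfolding x00 by (simp add: algebra_simps)
    also have "\<dots> \<le> \<alpha> 1 * (1 / 4)"
      using x11 pos by (intro mult_left_mono) auto
    finally show ?thesis by simp
  qed
  have part_b: "gap_12_3 E \<alpha> \<rho> \<le> (a - \<alpha> 3) / 4 + a / 4" if "\<alpha> 1 = a" "\<alpha> 2 = a" "a > \<alpha> 3" for a
  proof -
    \<comment> \<open>Here qubit 3 provides the first excitation.\<close>
    have others: "a \<le> ?d j" if "j \<noteq> ((0, 0), 0)" "j \<noteq> ((0, 0), 1)" for j
      using that pos \<open>\<alpha> 1 = a\<close> \<open>\<alpha> 2 = a\<close> bit_cases[of "fst (fst j)"] bit_cases[of "snd (fst j)"]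
        bit_cases[of "snd j"] by (auto simp: level_def prod_eq_iff)
    have "a - (a - \<alpha> 3) * (x (0, 0) + x (1, 0)) - \<alpha> 3 * x (0, 0) \<le>
        (\<Sum>k\<in>UNIV. ?d k * r k)"
      using r1 r2 that pos
      by (intro two_level_energy_le[where k = "((0, 0), 0)" and l = "((0, 0), 1)"] r others)
        (auto simp: level_def)
    with gap have "gap_12_3 E \<alpha> \<rho> \<le> (a - \<alpha> 3) * x (1, 0) + a * x (1, 1)"
      unfolding x00 that(1,2) by (simp add: algebra_simps)
    \<comment> \<open>Regrouped so that \<open>x (1, 0) + x (1, 1) \<le> 1/2\<close>, from pairing
      each with a larger eigenvalue, and \<open>x (1, 1) \<le> 1/4\<close> apply with nonnegative
      coefficients.\<close>
    also have "\<dots> = (a - \<alpha> 3) * (x (1, 0) + x (1, 1)) + \<alpha> 3 * x (1, 1)"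
      by (simp add: algebra_simps)
    also have "\<dots> \<le> (a - \<alpha> 3) * (1 / 2) + \<alpha> 3 * (1 / 4)"
      using x11 ord sum_x pos that by (intro add_mono mult_left_mono) auto
    finally show ?thesis by (simp add: field_simps)
  qed
  \<comment> \<open>This bound exceeds that of \<open>part_b\<close> by
    \<open>(2 * a - 3 * \<alpha> 3) / 12\<close>.\<close>
  have part_c: "gap_12_3 E \<alpha> \<rho> \<le> (a - \<alpha> 3) / 2 + a / 6"
    if "\<alpha> 1 = a" "\<alpha> 2 = a" "a > \<alpha> 3" "\<alpha> 3 \<le> 2 / 3 * a" for a
    using part_b[OF that(1-3)] that(4) by argo
  show ?thesis
    using part_a part_b part_c by blast
qed

end
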